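(* Suppose $\sigma_{\max}<1/\beta$ and $\theta^*\in\mathrm{relint}(\Theta)$. Consider the continuous-time limit of IGT-OMD, $$\dot\theta(t)=-\eta(t)\,g^{\mathrm{IGT}}\bigl(\theta(t),\{\theta(t-\tau_s)\}_{s\in Q(t)}\bigr),\qquad \eta(t)=\frac{\eta_0}{\sqrt{1+\beta\bar\sigma(t)}}.$$ Linearized around $\theta^*$, this system is asymptotically stable whenever $$\eta_0<\min\left\{\frac{1}{\|H_F\|\sqrt{1+\beta\sigma_{\max}}},\ \frac{\sqrt{1+\beta\sigma_{\max}}}{\sigma_{\max}\sqrt{\|L_{\mathrm{IGT}}\|}}\right\}.$$ (This is a sufficient local condition, for the bounded active-window embedding described in the context.)
   Context: $F(\theta)=\mathcal L_{\mathrm{true}}(w^*(\theta);\theta)$ on $\Theta\subseteq\mathbb R^p$, where $w^*(\theta)=\arg\min_w\mathcal L_{\mathrm{model}}(w;\theta)$; $\mathcal L_{\mathrm{model}}(\cdot;\theta)$ is $\mu_w$-strongly convex, both losses are $C^2$, and $F$ is strongly convex with minimizer (equilibrium) $\theta^*$. $H_F=\nabla^2F(\theta^* )$ is symmetric positive definite, $\|H_F\|=\lambda_{\max}(H_F)$. $L_{\mathrm{IGT}}=\nabla^2_{\theta w}\mathcal L_{\mathrm{model}}(w^*;\theta^* )[\nabla^2_{ww}\mathcal L_{\mathrm{model}}(w^*;\theta^* )]^{-1}\nabla^2_{w\theta}\mathcal L_{\mathrm{model}}(w^*;\theta^* )$ with $w^*=w^*(\theta^* )$. $\|\cdot\|$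 is the spectral norm, and $\beta=\|L_{\mathrm{IGT}}\|/\lambda_{\min}(H_F)$. $Q(t)$ is the set of feedback observations outstanding at time $t$, with delays $\tau_s>0$, $\sigma(t)=|Q(t)|\le\sigma_{\max}$, $\bar\sigma(t)=\sup_{r\le t}\sigma(r)$. $g^{\mathrm{IGT}}$ is the hypergradient estimator of the IGT-OMD algorithm (stale hypergradients re-evaluated at current parameters), with exact inner solutions ($\epsilon_{\mathrm{inner}}=0$). The linearization about $\theta^*$, with $\xi(t)=\theta(t)-\theta^*$, is the delay differential equation $$\dot\xi(t)=-\eta(t)H_F\,\xi(t)+\eta(t)L_{\mathrm{IGT}}\sum_{s\in Q(t)}\xi(t-\tau_s).$$ Bounded active-window embedding: each update event occupies time $\eta$, and $\sigma$ outstanding observations occupy a window of consecutive updates, so that the delay span is $\bar\tau=\sigma\eta$. *)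

theory Defs
  imports "HOL-Analysis.Analysis"
begin

section \<open>Derivatives, Hessian blocks and matrices\<close>

definition C2_on :: "'a::real_normed_vector set \<Rightarrow> ('a \<Rightarrow> real) \<Rightarrow> bool" where
  "C2_on S f \<longleftrightarrow> open S \<and>
     (\<exists>(f' :: 'a \<Rightarrow> 'a \<Rightarrow>\<^sub>L real) (f'' :: 'a \<Rightarrow> 'a \<Rightarrow>\<^sub>L ('a \<Rightarrow>\<^sub>L real)).
        (\<forall>x\<in>S. (f has_derivative blinfun_apply (f' x)) (at x)) \<and>
        (\<forall>x\<in>S. (f' has_derivative blinfun_apply (f'' x)) (at x)) \<and>
        continuous_on S f'')"

definition strongly_convex_on :: "'a::real_inner set \<Rightarrow> real \<Rightarrow> ('a \<Rightarrow> real) \<Rightarrow> bool" where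
  "strongly_convex_on S m f \<longleftrightarrow> convex S \<and>
     (\<forall>x\<in>S. \<forall>y\<in>S. \<forall>u\<ge>0. \<forall>v\<ge>0. u + v = 1 \<longrightarrow>
        f (u *\<^sub>R x + v *\<^sub>R y) \<le> u * f x + v * f y - m / 2 * u * v * (norm (x - y))\<^sup>2)"

definition gradient :: "('a::real_inner \<Rightarrow> real) \<Rightarrow> 'a \<Rightarrow> 'a" where
  "gradient f x = (THE D. GDERIV f x :> D)"

definition hessian :: "(real ^ 'n \<Rightarrow> real) \<Rightarrow> real ^ 'n \<Rightarrow> real ^ 'n ^ 'n" where
  "hessian f x = jacobian (gradient f) (at x)"

definition twice_differentiable_at :: "(real ^ 'n \<Rightarrow> real) \<Rightarrow> real ^ 'n \<Rightarrow> bool" where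
  "twice_differentiable_at f x \<longleftrightarrow>
     (\<forall>\<^sub>F y in nhds x. f differentiable (at y)) \<and> gradient f differentiable (at x)"

text \<open>In \<open>hess_tw\<close> rows are indexed by the coordinates of the outer variable \<open>\<theta>\<close> and columns by
  those of the inner variable \<open>w\<close>; in \<open>hess_wt\<close> it is the other way round.\<close>

definition hess_ww :: "(real ^ 'm \<Rightarrow> real ^ 'p \<Rightarrow> real) \<Rightarrow> real ^ 'm \<Rightarrow> real ^ 'p \<Rightarrow> real ^ 'm ^ 'm" where
  "hess_ww f w \<theta> = hessian (\<lambda>w'. f w' \<theta>) w"

definition hess_tw :: "(real ^ 'm \<Rightarrow> real ^ 'p \<Rightarrow> real) \<Rightarrow> real ^ 'm \<Rightarrow> real ^ 'p \<Rightarrow> real ^ 'm ^ 'p" where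
  "hess_tw f w \<theta> = jacobian (\<lambda>w'. gradient (\<lambda>\<theta>'. f w' \<theta>') \<theta>) (at w)"

definition hess_wt :: "(real ^ 'm \<Rightarrow> real ^ 'p \<Rightarrow> real) \<Rightarrow> real ^ 'm \<Rightarrow> real ^ 'p \<Rightarrow> real ^ 'p ^ 'm" where
  "hess_wt f w \<theta> = jacobian (\<lambda>\<theta>'. gradient (\<lambda>w'. f w' \<theta>') w) (at \<theta>)"

definition sym_pos_def :: "real ^ 'n ^ 'n \<Rightarrow> bool" where
  "sym_pos_def A \<longleftrightarrow> transpose A = A \<and> (\<forall>x. x \<noteq> 0 \<longrightarrow> x \<bullet> (A *v x) > 0)"

definition spectral_norm :: "real ^ 'n ^ 'm \<Rightarrow> real" where
  "spectral_norm A = onorm (\<lambda>x. A *v x)"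

text \<open>Used only for symmetric matrices, which have a least real eigenvalue.\<close>

definition lambda_min :: "real ^ 'n ^ 'n \<Rightarrow> real" where
  "lambda_min A = (LEAST k. \<exists>v. v \<noteq> 0 \<and> A *v v = k *\<^sub>R v)"

section \<open>The bilevel problem\<close>

definition inner_sol :: "('w \<Rightarrow> 't \<Rightarrow> real) \<Rightarrow> 't \<Rightarrow> 'w" where
  "inner_sol Lmodel \<theta> = (ARG_MIN (\<lambda>w. Lmodel w \<theta>) w. True)"

definition outer_obj :: "('w \<Rightarrow> 't \<Rightarrow> real) \<Rightarrow> ('w \<Rightarrow> 't \<Rightarrow> real) \<Rightarrow> 't \<Rightarrow> real" where
  "outer_obj Ltrue Lmodel \<theta> = Ltrue (inner_sol Lmodel \<theta>) \<theta>"

definition L_IGT :: "(real ^ 'm \<Rightarrow> real ^ 'p \<Rightarrow> real) \<Rightarrow> real ^ 'p \<Rightarrow> real ^ 'p ^ 'p" where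
  "L_IGT Lmodel \<theta> = (let w = inner_sol Lmodel \<theta> in
     hess_tw Lmodel w \<theta> ** matrix_inv (hess_ww Lmodel w \<theta>) ** hess_wt Lmodel w \<theta>)"

section \<open>Functional differential equations\<close>

text \<open>
  A right-hand side \<open>G t x\<close> may depend on the values of the trajectory \<open>x\<close> on \<open>[t - h, t]\<close>.
  The equation \<open>x'(t) = G t x\<close> is understood in its integrated (Caratheodory) form, because the
  right-hand sides of interest jump whenever the set of outstanding observations changes.
\<close>

definition solves_dde ::
  "(real \<Rightarrow> (real \<Rightarrow> 'a) \<Rightarrow> 'a) \<Rightarrow> real \<Rightarrow> real \<Rightarrow> (real \<Rightarrow> 'a::real_normed_vector) \<Rightarrow> bool" where
  "solves_dde G h t0 x \<longleftrightarrow> continuous_on {t0 - h..} x \<and>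
     (\<forall>t\<ge>t0. ((\<lambda>r. G r x) has_integral (x t - x t0)) {t0..t})"

text \<open>Asymptotic stability of the zero solution of a non-autonomous equation on \<open>[0, \<infinity>)\<close>:
  for every initial time it is Lyapunov stable and locally attractive, initial histories on
  \<open>[t0 - h, t0]\<close> being measured in the supremum norm.\<close>

definition asymptotically_stable ::
  "(real \<Rightarrow> (real \<Rightarrow> 'a) \<Rightarrow> 'a::real_normed_vector) \<Rightarrow> real \<Rightarrow> bool" where
  "asymptotically_stable G h \<longleftrightarrow> (\<forall>t0\<ge>0.
     (\<forall>\<epsilon>>0. \<exists>\<delta>>0. \<forall>x. solves_dde G h t0 x \<longrightarrow> (\<forall>r\<in>{t0 - h..t0}. norm (x r) < \<delta>) \<longrightarrow>
        (\<forall>t\<ge>t0. norm (x t) < \<epsilon>)) \<and>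
     (\<exists>b>0. \<forall>x. solves_dde G h t0 x \<longrightarrow> (\<forall>r\<in>{t0 - h..t0}. norm (x r) < b) \<longrightarrow>
        (x \<longlongrightarrow> 0) at_top))"

text \<open>The linearization of \<open>x'(t) = G t x\<close> about the constant trajectory \<open>x0\<close>.\<close>

definition linearize ::
  "(real \<Rightarrow> (real \<Rightarrow> 'a) \<Rightarrow> 'a::real_normed_vector) \<Rightarrow> 'a \<Rightarrow> real \<Rightarrow> (real \<Rightarrow> 'a) \<Rightarrow> 'a" where
  "linearize G x0 t \<xi> = vector_derivative (\<lambda>e. G t (\<lambda>r. x0 + e *\<^sub>R \<xi> r)) (at 0)"

text \<open>A map of a current value and of finitely many delayed values indexed by \<open>S\<close> vanishes when
  all of them equal \<open>x0\<close>, and \<open>A\<close> is its total (Frechet) derivative there.\<close>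

definition has_linearization ::
  "('a \<Rightarrow> ('s \<Rightarrow> 'a) \<Rightarrow> 'a::real_normed_vector) \<Rightarrow> 's set \<Rightarrow> 'a \<Rightarrow> ('a \<Rightarrow> ('s \<Rightarrow> 'a) \<Rightarrow> 'a) \<Rightarrow> bool" where
  "has_linearization f S x0 A \<longleftrightarrow> f x0 (\<lambda>_. x0) = 0 \<and>
     (\<forall>\<epsilon>>0. \<exists>\<delta>>0. \<forall>u v. norm u < \<delta> \<longrightarrow> (\<forall>s\<in>S. norm (v s) < \<delta>) \<longrightarrow>
        norm (f (x0 + u) (\<lambda>s. x0 + v s) - A u v) \<le> \<epsilon> * (norm u + (\<Sum>s\<in>S. norm (v s))))"

section \<open>The continuous-time limit of IGT-OMD\<close>

definition sigma_bar :: "(real \<Rightarrow> 's set) \<Rightarrow> real \<Rightarrow> nat" where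
  "sigma_bar Q t = (SUP r\<in>{0..t}. card (Q r))"

definition step_size :: "real \<Rightarrow> real \<Rightarrow> (real \<Rightarrow> 's set) \<Rightarrow> real \<Rightarrow> real" where
  "step_size \<eta>0 \<beta> Q t = \<eta>0 / sqrt (1 + \<beta> * real (sigma_bar Q t))"

text \<open>\<open>g S\<close> is the estimator for the set \<open>S\<close> of outstanding observations.\<close>

definition igt_flow ::
  "('s set \<Rightarrow> 'a \<Rightarrow> ('s \<Rightarrow> 'a) \<Rightarrow> 'a::real_normed_vector) \<Rightarrow> (real \<Rightarrow> real) \<Rightarrow> (real \<Rightarrow> 's set) \<Rightarrow>
   ('s \<Rightarrow> real) \<Rightarrow> real \<Rightarrow> (real \<Rightarrow> 'a) \<Rightarrow> 'a" where
  "igt_flow g \<eta> Q \<tau> t \<theta> = - (\<eta> t *\<^sub>R g (Q t) (\<theta> t) (\<lambda>s. \<theta> (t - \<tau> s)))"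

text \<open>Active-window embedding: at most \<open>\<sigma>max\<close> consecutive updates lie in the window, and each lasts
  at most \<open>\<eta> 0\<close>, the largest value of the nonincreasing step size \<open>\<eta>\<close>.\<close>

definition delay_span :: "nat \<Rightarrow> (real \<Rightarrow> real) \<Rightarrow> real" where
  "delay_span \<sigma>max \<eta> = real \<sigma>max * \<eta> 0"

end

theory Submission
  imports Defs "HOL-Real_Asymp.Real_Asymp"
begin

text \<open>
  Since \<open>\<sigma>\<^sub>m\<^sub>a\<^sub>x < 1/\<beta>\<close> means \<open>\<sigma>\<^sub>m\<^sub>a\<^sub>x \<parallel>L\<parallel> < \<lambda>\<^sub>m\<^sub>i\<^sub>n(H)\<close>, the instantaneous
  damping dominates all delayed terms together, and the linearization is stable whatever
  the bounded delays are (Halanay's inequality). Concretely, with a small \<open>\<gamma> > 0\<close> the barrier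
  \<open>b t = M exp (-\<gamma> (t - t0))\<close> is never reached by \<open>\<parallel>x t\<parallel>\<close>: at a first contact time
  the component of \<open>x\<close> along the direction \<open>x / \<parallel>x\<parallel>\<close> of contact would decrease at least as fast as \<open>b\<close>
  just before the contact, although it starts strictly below \<open>b\<close> there.
\<close>

section \<open>Symmetric matrices: least eigenvalue and spectral norm\<close>

text \<open>The quadratic form of \<open>K\<close> attains its minimum 0 at \<open>v\<close>, so its
  first variation there vanishes; in the direction \<open>K *v v\<close> that variation is twice the
  squared norm of \<open>K *v v\<close>.\<close>

lemma psd_kernel:
  fixes K :: "real ^ 'n ^ 'n"
  assumes sym: "transpose K = K" and psd: "\<And>x. 0 \<le> x \<bullet> (K *v x)" and v: "v \<bullet> (K *v v) = 0"
  shows "K *v v = 0"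
proof (rule ccontr)
  assume nz: "K *v v \<noteq> 0"
  define y where "y = K *v v"
  define d where "d = y \<bullet> y"
  define q where "q = y \<bullet> (K *v y)"
  have d: "d > 0" using nz by (simp add: d_def y_def)
  have q: "q \<ge> 0" by (simp add: q_def psd)
  have vy: "v \<bullet> (K *v y) = d"
    using dot_lmul_matrix[of v K y] sym
    by (metis d_def y_def transpose_matrix_vector)
  have quad: "0 \<le> 2 * t * d + t\<^sup>2 * q" for t
  proof -
    have "0 \<le> (v + t *\<^sub>R y) \<bullet> (K *v (v + t *\<^sub>R y))" by (rule psd)
    also have "\<dots> = 2 * t * d + t\<^sup>2 * q"
      using v vy
      by (simp add: matrix_vector_right_distrib matrix_vector_mult_scaleR inner_add_left
          inner_add_right q_def power2_eq_square y_def[symmetric] d_def algebra_simps)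
    finally show ?thesis .
  qed
  \<comment> \<open>A slightly negative \<open>t\<close> lets the linear term win. The minimizer
    would be \<open>- d / q\<close>; the denominator \<open>q + 1\<close> also covers
    \<open>q = 0\<close>.\<close>
  define t where "t = - d / (q + 1)"
  have t: "t * (q + 1) = - d" using q by (simp add: t_def)
  have tn: "t < 0" using d q by (simp add: t_def divide_neg_pos)
  have "2 * t * d + t\<^sup>2 * q = t * (2 * d + t * (q + 1) - t)"
    by (simp add: algebra_simps power2_eq_square)
  also have "\<dots> = t * (d - t)" by (simp add: t)
  also have "\<dots> < 0" using tn d by (simp add: mult_neg_pos)
  finally show False using quad[of t] by simp
qed

text \<open>\<open>LEAST\<close> over the reals says something only once a smallest eigenvalue is
  exhibited. It is the minimum \<open>m\<close> of the Rayleigh quotient, attained on the unit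
  sphere by compactness; every eigenvalue is itself a value of that quotient, hence at least
  \<open>m\<close>.\<close>

lemma lambda_min_symmetric:
  fixes A :: "real ^ 'n ^ 'n"
  assumes sym: "transpose A = A"
  shows lambda_min_eigenvector: "\<exists>v. v \<noteq> 0 \<and> A *v v = lambda_min A *\<^sub>R v"
    and lambda_min_le: "lambda_min A * (norm x)\<^sup>2 \<le> x \<bullet> (A *v x)"
proof -
  have "continuous_on (sphere 0 1) (\<lambda>x. x \<bullet> (A *v x))"
    by (intro continuous_intros matrix_vector_mult_linear_continuous_on)
  moreover have "sphere (0 :: real ^ 'n) 1 \<noteq> {}" by simp
  ultimately obtain v where v: "norm v = 1"
    and v_min: "\<And>x. norm x = 1 \<Longrightarrow> v \<bullet> (A *v v) \<le> x \<bullet> (A *v x)"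
    using continuous_attains_inf[OF compact_sphere, of 0 1 "\<lambda>x. x \<bullet> (A *v x)"]
    by (metis mem_sphere_0)
  define m where "m = v \<bullet> (A *v v)"
  have ray: "m * (norm x)\<^sup>2 \<le> x \<bullet> (A *v x)" for x
  proof (cases "x = 0")
    case False
    define u where "u = x /\<^sub>R norm x"
    have u: "x = norm x *\<^sub>R u" "norm u = 1" using False by (simp_all add: u_def)
    have "x \<bullet> (A *v x) = (norm x)\<^sup>2 * (u \<bullet> (A *v u))"
      by (subst u(1), subst (2) u(1)) (simp add: matrix_vector_mult_scaleR power2_eq_square)
    moreover have "m * (norm x)\<^sup>2 \<le> u \<bullet> (A *v u) * (norm x)\<^sup>2"
      using v_min[OF u(2)] by (intro mult_right_mono) (simp_all add: m_def)
    ultimately show ?thesis by (simp add: mult.commute)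
  qed simp
  \<comment> \<open>Shifting by the minimum gives a positive semidefinite matrix whose form vanishes
    at the minimizer \<open>v\<close>, so \<open>psd_kernel\<close> makes \<open>v\<close> an
    eigenvector for \<open>m\<close>.\<close>
  define K where "K = A - m *\<^sub>R mat 1"
  have K: "K *v x = A *v x - m *\<^sub>R x" for x
    by (simp add: K_def matrix_vector_mult_diff_rdistrib scaleR_matrix_vector_assoc[symmetric])
  have "transpose K = K"
    using sym by (simp add: K_def vec_eq_iff transpose_def mat_def)
  moreover have "0 \<le> x \<bullet> (K *v x)" for x
    using ray[of x] by (simp add: K inner_diff_right dot_square_norm)
  moreover have "v \<bullet> (K *v v) = 0"
    using v by (simp add: K inner_diff_right dot_square_norm m_def)
  ultimately have "K *v v = 0" by (rule psd_kernel)
  then have ev: "v \<noteq> 0 \<and> A *v v = m *\<^sub>R v"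
    using v by (auto simp: K)
  have least: "m \<le> k" if "w \<noteq> 0 \<and> A *v w = k *\<^sub>R w" for k w
    using ray[of w] that by (auto simp: dot_square_norm)
  have m: "lambda_min A = m"
    unfolding lambda_min_def by (rule Least_equality) (use ev least in blast)+
  show "\<exists>v. v \<noteq> 0 \<and> A *v v = lambda_min A *\<^sub>R v" using ev m by auto
  show "lambda_min A * (norm x)\<^sup>2 \<le> x \<bullet> (A *v x)" using ray m by simp
qed

lemma lambda_min_pos:
  assumes "sym_pos_def A"
  shows "lambda_min A > 0"
proof -
  obtain v where v: "v \<noteq> 0" "A *v v = lambda_min A *\<^sub>R v"
    using lambda_min_eigenvector assms unfolding sym_pos_def_def by blast
  then have "lambda_min A * (v \<bullet> v) > 0"
    using assms unfolding sym_pos_def_def by (metis inner_scaleR_right)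
  then show ?thesis using inner_ge_zero[of v] by (auto simp: zero_less_mult_iff)
qed

lemma spectral_norm_nonneg: "spectral_norm A \<ge> 0"
  unfolding spectral_norm_def by (rule onorm_pos_le) simp

lemma norm_matrix_vector_le: "norm (A *v x) \<le> spectral_norm A * norm x"
  unfolding spectral_norm_def by (rule onorm) simp

section \<open>Exponential decay by comparison with a barrier\<close>

text \<open>At \<gamma> = 0 the inequality reads \<open>0 < c * (a - k)\<close>, which is strict and
  so persists for small positive \<gamma>. The factor \<open>exp (\<gamma> * h)\<close> is the
  growth of the barrier when looking back over the delay window.\<close>

lemma exists_decay_rate:
  fixes a c k h :: real
  assumes "k < a" "c > 0"
  shows "\<exists>\<gamma>>0. \<gamma> < c * (a - k * exp (\<gamma> * h))"
proof -
  have "((\<lambda>\<gamma>. c * (a - k * exp (\<gamma> * h)) - \<gamma>) \<longlongrightarrow> c * (a - k * exp (0 * h)) - 0) (at_right 0)"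
    by (intro tendsto_intros)
  then have "\<forall>\<^sub>F \<gamma> in at_right 0. 0 < c * (a - k * exp (\<gamma> * h)) - \<gamma>"
    by (rule order_tendstoD(1)) (use assms in simp)
  then obtain d where d: "d > 0" "\<And>\<gamma>. 0 < \<gamma> \<Longrightarrow> \<gamma> < d \<Longrightarrow> 0 < c * (a - k * exp (\<gamma> * h)) - \<gamma>"
    unfolding eventually_at_right_field by (auto simp: eventually_at_right_field)
  show ?thesis by (rule exI[of _ "d / 2"]) (use d(1) d(2)[of "d / 2"] in auto)
qed

text \<open>The zeros of \<open>f - b\<close> in \<open>[t0, T]\<close> form a nonempty closed set,
  whose infimum is the contact time. Any earlier time with \<open>b t \<le> f t\<close> would yield
  an earlier zero by the intermediate value theorem.\<close>

lemma first_contact_time: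
  fixes f b :: "real \<Rightarrow> real"
  assumes cf: "continuous_on {t0..} f" and cb: "continuous_on {t0..} b"
    and init: "f t0 < b t0" and T: "t0 \<le> T" "b T \<le> f T"
  obtains t1 where "t0 < t1" "f t1 = b t1" "\<And>t. t0 \<le> t \<Longrightarrow> t < t1 \<Longrightarrow> f t < b t"
proof -
  define d where "d = (\<lambda>t. f t - b t)"
  have cd: "continuous_on {t0..t} d" for t
    unfolding d_def by (intro continuous_intros continuous_on_subset[OF cf] continuous_on_subset[OF cb]) auto
  have ivt: "\<exists>s\<ge>t0. s \<le> t \<and> d s = 0" if "t0 \<le> t" "0 \<le> d t" for t
    using IVT'[of d t0 0 t] that init cd[of t] by (auto simp: d_def)
  define S where "S = {t\<in>{t0..T}. d t = 0}"
  have "S \<noteq> {}" using ivt[of T] T by (auto simp: S_def d_def)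
  moreover have "closed S"
    unfolding S_def by (rule continuous_closed_preimage_constant[OF cd]) simp
  moreover have bd: "bdd_below S" by (auto simp: S_def)
  ultimately have inS: "Inf S \<in> S" by (simp add: closed_contains_Inf)
  show thesis
  proof
    show "f (Inf S) = b (Inf S)" using inS by (simp add: S_def d_def)
    with inS init show "t0 < Inf S" by (auto simp: S_def less_le)
    show "f t < b t" if t: "t0 \<le> t" "t < Inf S" for t
    proof (rule ccontr)
      assume "\<not> f t < b t"
      then obtain s where s: "t0 \<le> s" "s \<le> t" "d s = 0" using ivt[of t] t by (auto simp: d_def)
      with t inS have "s \<in> S" by (auto simp: S_def)
      then have "Inf S \<le> s" using bd by (rule cInf_lower)
      with s t show False by simp
    qed
  qed
qed

text \<open>The delayed terms enter only through \<open>w\<close>, bounded by \<open>k\<close> times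
  the supremum over the window. The equation is in integrated form and \<open>c\<close>,
  \<open>w\<close> may jump, so the contradiction comes from integrating over a short interval
  before contact, not from a derivative at the contact time.\<close>

lemma halanay:
  fixes x w :: "real \<Rightarrow> 'a::real_inner" and A :: "'a \<Rightarrow> 'a" and c :: "real \<Rightarrow> real"
  assumes cont: "continuous_on {t0 - h..} x"
    and int: "\<And>t. t \<ge> t0 \<Longrightarrow> ((\<lambda>r. - (c r *\<^sub>R (A (x r) - w r))) has_integral (x t - x t0)) {t0..t}"
    and A: "bounded_linear A" "\<And>v. a * (norm v)\<^sup>2 \<le> v \<bullet> A v"
    and w: "\<And>r B. t0 \<le> r \<Longrightarrow> \<forall>q\<in>{r - h..r}. norm (x q) \<le> B \<Longrightarrow> norm (w r) \<le> k * B"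
    and c: "\<And>r. t0 \<le> r \<Longrightarrow> cmin \<le> c r" "0 < cmin"
    and h: "0 \<le> h"
    and \<gamma>: "0 < \<gamma>" "\<gamma> < cmin * (a - k * exp (\<gamma> * h))"
    and init: "\<And>r. r \<in> {t0 - h..t0} \<Longrightarrow> norm (x r) < M"
    and t: "t0 \<le> t"
  shows "norm (x t) < M * exp (- \<gamma> * (t - t0))"
proof (rule ccontr)
  define b where "b = (\<lambda>t. M * exp (- \<gamma> * (t - t0)))"
  assume "\<not> ?thesis"
  then have hit: "b t \<le> norm (x t)" by (simp add: b_def)
  have init0: "norm (x t0) < M" using init[of t0] h by simp
  then have M: "M > 0" using norm_ge_zero[of "x t0"] by linarith
  have b_anti: "b s \<le> b r" if "r \<le> s" for r s
    using that M \<gamma>(1) by (simp add: b_def)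
  have b_shift: "b (r - h) = exp (\<gamma> * h) * b r" for r
    by (simp add: b_def mult_exp_exp algebra_simps)
  have cx: "continuous_on {t0..} x" by (rule continuous_on_subset[OF cont]) (use h in auto)
  have cb: "continuous_on S b" for S unfolding b_def by (intro continuous_intros)
  obtain t1 where t1: "t0 < t1" "norm (x t1) = b t1"
    and below: "\<And>r. t0 \<le> r \<Longrightarrow> r < t1 \<Longrightarrow> norm (x r) < b r"
    by (rule first_contact_time[OF continuous_on_norm[OF cx] cb _ t hit])
       (use init0 in \<open>auto simp: b_def\<close>)
  \<comment> \<open>On the initial history the extended barrier is at least \<open>M\<close>, so one
    bound covers every delayed time up to contact.\<close>
  have le_b: "norm (x r) \<le> b r" if "t0 - h \<le> r" "r \<le> t1" for r
  proof (cases "r \<le> t0")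
    case True
    then show ?thesis using init[of r] that(1) b_anti[of r t0] by (simp add: b_def)
  next
    case False
    then show ?thesis using below[of r] t1(2) that by (cases "r = t1") auto
  qed
  have w_le: "norm (w r) \<le> k * (exp (\<gamma> * h) * b r)" if "t0 \<le> r" "r \<le> t1" for r
  proof (rule w)
    show "\<forall>q\<in>{r - h..r}. norm (x q) \<le> exp (\<gamma> * h) * b r"
      using that le_b b_anti unfolding b_shift[symmetric]
      by (smt (verit, best) atLeastAtMost_iff)
  qed fact
  have b1: "b t1 > 0" using M by (simp add: b_def)
  \<comment> \<open>This is the unit contact direction. The scalar \<open>v \<bullet> x r\<close>
    equals the barrier at \<open>t1\<close> and, by Cauchy-Schwarz, lies strictly below it
    earlier.\<close>
  define v where "v = x t1 /\<^sub>R b t1"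
  have v: "norm v = 1" "x t1 = b t1 *\<^sub>R v" using b1 t1(2) by (simp_all add: v_def)
  \<comment> \<open>\<open>w\<close> need not be continuous, so its contribution is replaced by its
    worst case. The resulting lower bound \<open>E\<close> is continuous, and the strict inequality
    at \<open>t1\<close> extends to times just before it.\<close>
  define E where "E = (\<lambda>r. v \<bullet> A (x r) - k * exp (\<gamma> * h) * b r)"
  have cE: "continuous_on {t0..t1} (\<lambda>r. cmin * E r - \<gamma> * b r)"
    unfolding E_def
    by (intro continuous_intros cb bounded_linear.continuous_on[OF A(1)] continuous_on_subset[OF cx]) auto
  have "a * b t1 \<le> v \<bullet> A (x t1)"
    using A(2)[of v] v b1 bounded_linear.linear[OF A(1)]
    by (simp add: linear_scale mult.commute mult_left_mono)
  then have "(a - k * exp (\<gamma> * h)) * b t1 \<le> E t1" by (simp add: E_def algebra_simps)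
  then have "cmin * (a - k * exp (\<gamma> * h)) * b t1 \<le> cmin * E t1"
    using c(2) by (simp add: mult.assoc)
  moreover have "\<gamma> * b t1 < cmin * (a - k * exp (\<gamma> * h)) * b t1"
    using \<gamma>(2) b1 by (rule mult_strict_right_mono)
  ultimately have "0 < cmin * E t1 - \<gamma> * b t1" by simp
  then obtain d where d: "d > 0"
    "\<And>r. r \<in> {t0..t1} \<Longrightarrow> dist r t1 < d \<Longrightarrow> 0 < cmin * E r - \<gamma> * b r"
  proof -
    assume pos: "0 < cmin * E t1 - \<gamma> * b t1"
      and *: "\<And>d. d > 0 \<Longrightarrow> (\<And>r. r \<in> {t0..t1} \<Longrightarrow> dist r t1 < d \<Longrightarrow> 0 < cmin * E r - \<gamma> * b r) \<Longrightarrow> thesis"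
    have "t1 \<in> {t0..t1}" using t1 by simp
    with cE pos obtain d where "d > 0" and
      "\<forall>r\<in>{t0..t1}. dist r t1 < d \<longrightarrow> dist (cmin * E r - \<gamma> * b r) (cmin * E t1 - \<gamma> * b t1) < cmin * E t1 - \<gamma> * b t1"
      unfolding continuous_on_iff by blast
    then show thesis by (intro *[of d]) (auto simp: dist_real_def abs_if split: if_splits)
  qed
  \<comment> \<open>Halving \<open>d\<close> keeps the distance to \<open>t1\<close> strictly below
    \<open>d\<close>; the maximum keeps the interval after \<open>t0\<close>.\<close>
  define t2 where "t2 = max t0 (t1 - d / 2)"
  have t2: "t0 \<le> t2" "t2 < t1" using t1 d(1) by (auto simp: t2_def)
  have near: "\<gamma> * b r \<le> cmin * E r" if "t2 \<le> r" "r \<le> t1" for r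
    using d(2)[of r] d(1) that by (simp add: dist_real_def t2_def)
  have slope: "v \<bullet> (- (c r *\<^sub>R (A (x r) - w r))) \<le> - \<gamma> * b r" if r: "t2 \<le> r" "r \<le> t1" for r
  proof -
    have r0: "t0 \<le> r" using r t2 by simp
    have "v \<bullet> w r \<le> norm (w r)" using Cauchy_Schwarz_ineq2[of v "w r"] v(1) by simp
    also note w_le[OF r0 r(2)]
    finally have E_le: "E r \<le> v \<bullet> (A (x r) - w r)" by (simp add: E_def inner_diff_right algebra_simps)
    \<comment> \<open>The sign of \<open>E r\<close> matters: passing from \<open>cmin\<close> to
      the larger \<open>c r\<close> increases the product only for a nonnegative factor.\<close>
    have "0 \<le> \<gamma> * b r" using \<gamma>(1) M by (simp add: b_def)
    with near[OF r] have "0 \<le> cmin * E r" by linarith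
    then have "0 \<le> E r" using c(2) by (simp add: zero_le_mult_iff)
    then have "cmin * E r \<le> c r * (v \<bullet> (A (x r) - w r))"
      using c(1)[OF r0] c(2) E_le by (intro mult_mono) auto
    with near[OF r] show ?thesis by simp
  qed
  let ?g = "\<lambda>r. v \<bullet> (- (c r *\<^sub>R (A (x r) - w r)))"
  have int_v: "(?g has_integral v \<bullet> (x s - x t0)) {t0..s}" if "t0 \<le> s" for s
    using has_integral_linear[OF int[OF that] bounded_linear_inner_right[of v]] by (simp add: o_def)
  \<comment> \<open>The equation provides integrals starting at \<open>t0\<close> only, so the
    integral over \<open>[t2, t1]\<close> is obtained by subtraction.\<close>
  have "(?g has_integral v \<bullet> (x t1 - x t2)) {t2..t1}"
  proof -
    have "?g integrable_on {t2..t1}"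
      by (rule integrable_subinterval_real[OF has_integral_integrable[OF int_v[OF less_imp_le[OF t1(1)]]]]) (use t2 in simp)
    then obtain j where j: "(?g has_integral j) {t2..t1}" by blast
    have "(?g has_integral v \<bullet> (x t2 - x t0) + j) {t0..t1}"
      using has_integral_combine[OF _ _ int_v[OF t2(1)] j] t2 by simp
    with int_v[OF less_imp_le[OF t1(1)]] have "v \<bullet> (x t1 - x t0) = v \<bullet> (x t2 - x t0) + j"
      by (rule has_integral_unique)
    then have "j = v \<bullet> (x t1 - x t2)" by (simp add: inner_diff_right)
    with j show ?thesis by simp
  qed
  moreover have "((\<lambda>r. - \<gamma> * b r) has_integral b t1 - b t2) {t2..t1}"
    using t2(2) unfolding b_def
    by (intro fundamental_theorem_of_calculus)
       (auto intro!: derivative_eq_intros simp flip: has_real_derivative_iff_has_vector_derivative)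
  \<comment> \<open>The component falls at least as much as the barrier and meets it at
    \<open>t1\<close>, so it cannot have been strictly below it at \<open>t2\<close>.\<close>
  ultimately have "v \<bullet> (x t1 - x t2) \<le> b t1 - b t2"
    by (rule has_integral_le) (use slope in auto)
  moreover have "v \<bullet> x t1 = b t1" using v by (simp add: dot_square_norm)
  moreover have "v \<bullet> x t2 < b t2"
    using Cauchy_Schwarz_ineq2[of v "x t2"] v(1) below[OF t2] by simp
  ultimately show False by (simp add: inner_diff_right)
qed

section \<open>Asymptotic stability from exponential decay\<close>

text \<open>One rate \<gamma> serves all initial times and all history bounds \<open>M\<close>. A
  trajectory therefore never exceeds the bound on its history, so \<delta> = \<epsilon> gives
  Lyapunov stability, and any radius, here 1, gives attraction.\<close>

lemma asymptotically_stable_damped: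
  fixes G :: "real \<Rightarrow> (real \<Rightarrow> 'a) \<Rightarrow> 'a::real_inner"
  assumes G: "\<And>t x. t \<ge> 0 \<Longrightarrow> G t x = - (c t *\<^sub>R (A (x t) - W t x))"
    and A: "bounded_linear A" "\<And>v. a * (norm v)\<^sup>2 \<le> v \<bullet> A v"
    and W: "\<And>t x B. 0 \<le> t \<Longrightarrow> \<forall>q\<in>{t - h..t}. norm (x q) \<le> B \<Longrightarrow> norm (W t x) \<le> k * B"
    and c: "\<And>t. 0 \<le> t \<Longrightarrow> cmin \<le> c t" "0 < cmin"
    and h: "0 \<le> h" and "k < a"
  shows "asymptotically_stable G h"
proof -
  obtain \<gamma> where \<gamma>: "0 < \<gamma>" "\<gamma> < cmin * (a - k * exp (\<gamma> * h))"
    using exists_decay_rate[OF \<open>k < a\<close> c(2)] by blast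
  have decay: "norm (x t) < M * exp (- \<gamma> * (t - t0))"
    if t0: "0 \<le> t0" and x: "solves_dde G h t0 x" and M: "\<forall>r\<in>{t0 - h..t0}. norm (x r) < M" and t: "t0 \<le> t"
    for t0 x M t
  proof (rule halanay[where A = A and w = "\<lambda>r. W r x" and c = c, OF _ _ A _ _ c(2) h \<gamma> _ t])
    show "continuous_on {t0 - h..} x" using x by (simp add: solves_dde_def)
    show "((\<lambda>r. - (c r *\<^sub>R (A (x r) - W r x))) has_integral x t - x t0) {t0..t}" if "t0 \<le> t" for t
    proof (rule has_integral_eq)
      show "((\<lambda>r. G r x) has_integral x t - x t0) {t0..t}" using x that by (simp add: solves_dde_def)
    qed (use t0 G in auto)
  qed (use W c t0 M in auto)
  show ?thesis
    unfolding asymptotically_stable_def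
  proof (intro allI impI conjI)
    fix t0 \<epsilon> :: real
    assume t0: "0 \<le> t0" and \<epsilon>: "0 < \<epsilon>"
    show "\<exists>\<delta>>0. \<forall>x. solves_dde G h t0 x \<longrightarrow> (\<forall>r\<in>{t0 - h..t0}. norm (x r) < \<delta>) \<longrightarrow>
        (\<forall>t\<ge>t0. norm (x t) < \<epsilon>)"
    proof (intro exI[of _ \<epsilon>] conjI allI impI \<epsilon>)
      fix x t
      assume "solves_dde G h t0 x" "\<forall>r\<in>{t0 - h..t0}. norm (x r) < \<epsilon>" and t: "t0 \<le> t"
      then have "norm (x t) < \<epsilon> * exp (- \<gamma> * (t - t0))" using t0 by (intro decay)
      also have "\<dots> \<le> \<epsilon> * 1" using \<epsilon> \<gamma>(1) t by (intro mult_left_mono) auto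
      finally show "norm (x t) < \<epsilon>" by simp
    qed
  next
    fix t0 :: real
    assume t0: "0 \<le> t0"
    show "\<exists>b>0. \<forall>x. solves_dde G h t0 x \<longrightarrow> (\<forall>r\<in>{t0 - h..t0}. norm (x r) < b) \<longrightarrow>
        (x \<longlongrightarrow> 0) at_top"
    proof (intro exI[of _ 1] conjI allI impI)
      fix x
      assume x: "solves_dde G h t0 x" "\<forall>r\<in>{t0 - h..t0}. norm (x r) < 1"
      show "(x \<longlongrightarrow> 0) at_top"
      proof (rule Lim_null_comparison)
        show "\<forall>\<^sub>F t in at_top. norm (x t) \<le> 1 * exp (- \<gamma> * (t - t0))"
          using eventually_ge_at_top[of t0]
          by eventually_elim (use decay[OF t0 x] in \<open>auto intro: less_imp_le\<close>)
        show "((\<lambda>t. 1 * exp (- \<gamma> * (t - t0))) \<longlongrightarrow> 0) at_top"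
          using \<gamma>(1) by real_asymp
      qed
    qed simp
  qed
qed

section \<open>Linearized flow and lower bound on the step size\<close>

text \<open>\<open>linearize\<close> differentiates along the ray
  \<open>x0 + e *\<^sub>R \<xi>\<close>. The total derivative of the estimator determines this ray
  derivative, homogeneity of \<open>A\<close> pulls out \<open>e\<close>, and the step size passes
  through because it does not depend on the trajectory.\<close>

lemma linearize_igt_flow:
  fixes A :: "'a \<Rightarrow> ('s \<Rightarrow> 'a) \<Rightarrow> 'a::real_normed_vector"
  assumes lin: "has_linearization (g (Q t)) (Q t) x0 A" and fin: "finite (Q t)"
    and hom: "\<And>e u v. A (e *\<^sub>R u) (\<lambda>s. e *\<^sub>R v s) = e *\<^sub>R A u v"
  shows "linearize (igt_flow g \<eta> Q \<tau>) x0 t \<xi> = - (\<eta> t *\<^sub>R A (\<xi> t) (\<lambda>s. \<xi> (t - \<tau> s)))"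
proof -
  let ?u = "\<xi> t" and ?v = "\<lambda>s. \<xi> (t - \<tau> s)"
  define f where "f = (\<lambda>e::real. g (Q t) (x0 + e *\<^sub>R ?u) (\<lambda>s. x0 + e *\<^sub>R ?v s))"
  define N where "N = norm ?u + (\<Sum>s\<in>Q t. norm (?v s))"
  have N: "0 \<le> N" "norm ?u \<le> N" "\<And>s. s \<in> Q t \<Longrightarrow> norm (?v s) \<le> N"
  proof -
    show 0: "0 \<le> N" "norm ?u \<le> N" by (auto simp: N_def intro!: add_nonneg_nonneg sum_nonneg)
    show "norm (?v s) \<le> N" if "s \<in> Q t" for s
      using member_le_sum[OF that, of "\<lambda>s. norm (?v s)"] fin
      by (simp add: N_def add_increasing)
  qed
  have f0: "f 0 = 0" using lin by (simp add: f_def has_linearization_def)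
  have "(f has_derivative (\<lambda>e. e *\<^sub>R A ?u ?v)) (at 0)"
    unfolding has_derivative_at_alt
  proof (intro conjI allI impI)
    show "bounded_linear (\<lambda>e. e *\<^sub>R A ?u ?v)" by (rule bounded_linear_scaleR_left)
    fix \<epsilon> :: real
    assume "0 < \<epsilon>"
    \<comment> \<open>The estimator error along the ray is at most
      \<open>\<epsilon>' * N * \<bar>e\<bar>\<close>; dividing by \<open>N + 1\<close> also covers
      the zero direction \<open>N = 0\<close>.\<close>
    define \<epsilon>' where "\<epsilon>' = \<epsilon> / (N + 1)"
    have \<epsilon>': "0 < \<epsilon>'" "\<epsilon>' * N \<le> \<epsilon>"
      using \<open>0 < \<epsilon>\<close> N(1) by (auto simp: \<epsilon>'_def field_simps)
    obtain \<delta> where \<delta>: "\<delta> > 0" and approx: "\<And>u v. norm u < \<delta> \<Longrightarrow> \<forall>s\<in>Q t. norm (v s) < \<delta> \<Longrightarrow>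
        norm (g (Q t) (x0 + u) (\<lambda>s. x0 + v s) - A u v) \<le> \<epsilon>' * (norm u + (\<Sum>s\<in>Q t. norm (v s)))"
      using lin \<epsilon>'(1) unfolding has_linearization_def by meson
    show "\<exists>d>0. \<forall>e. norm (e - 0) < d \<longrightarrow> norm (f e - f 0 - (e - 0) *\<^sub>R A ?u ?v) \<le> \<epsilon> * norm (e - 0)"
    proof (intro exI[of _ "\<delta> / (N + 1)"] conjI allI impI)
      show "0 < \<delta> / (N + 1)" using \<delta> N(1) by simp
      fix e :: real
      assume "norm (e - 0) < \<delta> / (N + 1)"
      then have e: "\<bar>e\<bar> * (N + 1) < \<delta>" using N(1) by (simp add: field_simps)
      have small: "norm (e *\<^sub>R y) < \<delta>" if "norm y \<le> N" for y :: 'a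
      proof -
        have "norm (e *\<^sub>R y) \<le> \<bar>e\<bar> * (N + 1)" using that by (simp add: mult_left_mono)
        with e show ?thesis by simp
      qed
      have "norm (f e - e *\<^sub>R A ?u ?v)
          \<le> \<epsilon>' * (norm (e *\<^sub>R ?u) + (\<Sum>s\<in>Q t. norm (e *\<^sub>R ?v s)))"
        unfolding f_def hom[symmetric] by (rule approx) (use small N in auto)
      also have "\<dots> = (\<epsilon>' * N) * \<bar>e\<bar>" by (simp add: N_def sum_distrib_left algebra_simps)
      also have "\<dots> \<le> \<epsilon> * \<bar>e\<bar>" using \<epsilon>'(2) by (rule mult_right_mono) simp
      finally show "norm (f e - f 0 - (e - 0) *\<^sub>R A ?u ?v) \<le> \<epsilon> * norm (e - 0)" by (simp add: f0)
    qed
  qed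
  then have "(f has_vector_derivative A ?u ?v) (at 0)" by (simp add: has_vector_derivative_def)
  then have "((\<lambda>e. - (\<eta> t *\<^sub>R f e)) has_vector_derivative - (\<eta> t *\<^sub>R A ?u ?v)) (at 0)"
    by (auto intro!: derivative_eq_intros)
  then show ?thesis
    unfolding linearize_def igt_flow_def f_def by (rule vector_derivative_at)
qed

text \<open>The bound \<open>n\<close> on the outstanding sets also bounds their running maximum.
  The step size thus stays away from zero, which gives a uniform decay rate.\<close>

lemma step_size_ge:
  assumes "0 \<le> \<eta>0" "0 \<le> \<beta>" "0 \<le> t" and card: "\<And>r. 0 \<le> r \<Longrightarrow> card (Q r) \<le> n"
  shows "\<eta>0 / sqrt (1 + \<beta> * real n) \<le> step_size \<eta>0 \<beta> Q t"
proof -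
  have "sigma_bar Q t \<le> n"
    unfolding sigma_bar_def by (rule cSUP_least) (use assms in auto)
  then have "sqrt (1 + \<beta> * real (sigma_bar Q t)) \<le> sqrt (1 + \<beta> * real n)"
    using \<open>0 \<le> \<beta>\<close> by (simp add: mult_left_mono)
  moreover have "0 < sqrt (1 + \<beta> * real (sigma_bar Q t))"
    using \<open>0 \<le> \<beta>\<close> by (simp add: add_pos_nonneg)
  ultimately show ?thesis
    unfolding step_size_def using \<open>0 \<le> \<eta>0\<close> by (intro divide_left_mono) auto
qed

section \<open>Stability of the linearized IGT-OMD flow\<close>

theorem proposition1:
  fixes Ltrue Lmodel :: "real ^ 'm \<Rightarrow> real ^ 'p \<Rightarrow> real"
    and U \<Theta> :: "(real ^ 'p) set"
    and \<theta>s :: "real ^ 'p"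
    and H L :: "real ^ 'p ^ 'p"
    and \<mu>w \<mu>F \<beta> \<eta>0 :: real
    and \<sigma>max :: nat
    and Q :: "real \<Rightarrow> 's set"
    and \<tau> :: "'s \<Rightarrow> real"
    and \<eta> :: "real \<Rightarrow> real"
    and g :: "'s set \<Rightarrow> real ^ 'p \<Rightarrow> ('s \<Rightarrow> real ^ 'p) \<Rightarrow> real ^ 'p"
  assumes "open U" and "\<Theta> \<subseteq> U"
    and "C2_on (UNIV \<times> U) (\<lambda>(w, \<theta>). Ltrue w \<theta>)"
    and "C2_on (UNIV \<times> U) (\<lambda>(w, \<theta>). Lmodel w \<theta>)"
    and "\<mu>w > 0" and "\<And>\<theta>. \<theta> \<in> U \<Longrightarrow> strongly_convex_on UNIV \<mu>w (\<lambda>w. Lmodel w \<theta>)"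
    and "\<mu>F > 0" and "strongly_convex_on \<Theta> \<mu>F (outer_obj Ltrue Lmodel)"
    and "is_arg_min (outer_obj Ltrue Lmodel) (\<lambda>\<theta>. \<theta> \<in> \<Theta>) \<theta>s"
    and "\<theta>s \<in> rel_interior \<Theta>"
    and "twice_differentiable_at (outer_obj Ltrue Lmodel) \<theta>s"
    and "H = hessian (outer_obj Ltrue Lmodel) \<theta>s" and "sym_pos_def H"
    and "L = L_IGT Lmodel \<theta>s"
    and "\<beta> = spectral_norm L / lambda_min H"
    and "\<And>t. t \<ge> 0 \<Longrightarrow> finite (Q t)" and "\<And>t. t \<ge> 0 \<Longrightarrow> card (Q t) \<le> \<sigma>max"
    and "ereal (real \<sigma>max) < 1 / ereal \<beta>"
    and "\<eta>0 > 0" and "\<eta> = step_size \<eta>0 \<beta> Q"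
    and "\<And>t s. t \<ge> 0 \<Longrightarrow> s \<in> Q t \<Longrightarrow> 0 < \<tau> s \<and> \<tau> s \<le> delay_span \<sigma>max \<eta>"
    and "\<And>t. t \<ge> 0 \<Longrightarrow>
      has_linearization (g (Q t)) (Q t) \<theta>s (\<lambda>u v. H *v u - L *v (\<Sum>s\<in>Q t. v s))"
    and "ereal \<eta>0 < min
      (1 / ereal (spectral_norm H * sqrt (1 + \<beta> * real \<sigma>max)))
      (ereal (sqrt (1 + \<beta> * real \<sigma>max)) / ereal (real \<sigma>max * sqrt (spectral_norm L)))"
  shows "asymptotically_stable (linearize (igt_flow g \<eta> Q \<tau>) \<theta>s) (delay_span \<sigma>max \<eta>)"
proof -
  have Q: "finite (Q t)" "card (Q t) \<le> \<sigma>max" if "0 \<le> t" for t using assms that by auto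
  have delay: "0 < \<tau> s" "\<tau> s \<le> delay_span \<sigma>max \<eta>" if "0 \<le> t" "s \<in> Q t" for t s
    using assms that by auto
  have lin: "has_linearization (g (Q t)) (Q t) \<theta>s (\<lambda>u v. H *v u - L *v (\<Sum>s\<in>Q t. v s))"
    if "0 \<le> t" for t using assms that by auto
  have H: "sym_pos_def H" and \<beta>: "\<beta> = spectral_norm L / lambda_min H"
    and \<sigma>: "ereal (real \<sigma>max) < 1 / ereal \<beta>" and \<eta>0: "0 < \<eta>0" and \<eta>: "\<eta> = step_size \<eta>0 \<beta> Q"
    using assms by auto
  have \<lambda>: "0 < lambda_min H" using H by (rule lambda_min_pos)
  then have \<beta>0: "0 \<le> \<beta>" using spectral_norm_nonneg[of L] by (simp add: \<beta>)
  define cmin where "cmin = \<eta>0 / sqrt (1 + \<beta> * real \<sigma>max)"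
  have cmin: "0 < cmin" using \<eta>0 \<beta>0 by (simp add: cmin_def add_pos_nonneg)
  have \<eta>_ge: "cmin \<le> \<eta> t" if "0 \<le> t" for t
    unfolding cmin_def \<eta> using \<eta>0 \<beta>0 that Q(2) by (intro step_size_ge) auto
  \<comment> \<open>This is \<open>\<sigma>max < 1 / \<beta>\<close> cleared of denominators. The
    case \<beta> = 0 is separate because \<open>1 / ereal 0\<close> is infinite; there the norm of
    \<open>L\<close> is zero.\<close>
  have dominance: "spectral_norm L * real \<sigma>max < lambda_min H"
  proof (cases "\<beta> = 0")
    case True
    then have "spectral_norm L = 0" using \<lambda> by (simp add: \<beta>)
    then show ?thesis using \<lambda> by simp
  next
    case False
    then have "real \<sigma>max < 1 / \<beta>" using \<sigma> by (simp add: one_ereal_def)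
    then have "real \<sigma>max * \<beta> < 1" using False \<beta>0 by (simp add: field_simps)
    then show ?thesis using \<lambda> by (simp add: \<beta> field_simps)
  qed
  show ?thesis
  \<comment> \<open>The damping is the least eigenvalue of \<open>H\<close>; the total gain of at
    most \<open>\<sigma>max\<close> delayed terms is
    \<open>spectral_norm L * real \<sigma>max\<close>.\<close>
  proof (rule asymptotically_stable_damped[where A = "(*v) H" and c = \<eta> and cmin = cmin
        and a = "lambda_min H" and k = "spectral_norm L * real \<sigma>max"
        and W = "\<lambda>t x. L *v (\<Sum>s\<in>Q t. x (t - \<tau> s))"])
    show "linearize (igt_flow g \<eta> Q \<tau>) \<theta>s t \<xi> =
        - (\<eta> t *\<^sub>R (H *v \<xi> t - L *v (\<Sum>s\<in>Q t. \<xi> (t - \<tau> s))))" if "0 \<le> t" for t \<xi>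
    proof (rule linearize_igt_flow[where g = g and Q = Q and A = "\<lambda>u v. H *v u - L *v (\<Sum>s\<in>Q t. v s)"])
      show "H *v (e *\<^sub>R u) - L *v (\<Sum>s\<in>Q t. e *\<^sub>R v s) = e *\<^sub>R (H *v u - L *v (\<Sum>s\<in>Q t. v s))" for e u v
        by (simp add: matrix_vector_mult_scaleR scaleR_diff_right flip: scaleR_sum_right)
    qed (rule lin[OF that], rule Q(1)[OF that])
    show "lambda_min H * (norm v)\<^sup>2 \<le> v \<bullet> (H *v v)" for v
      using H by (intro lambda_min_le) (simp add: sym_pos_def_def)
    show "norm (L *v (\<Sum>s\<in>Q t. x (t - \<tau> s))) \<le> spectral_norm L * real \<sigma>max * B"
      if t: "0 \<le> t" and B: "\<forall>q\<in>{t - delay_span \<sigma>max \<eta>..t}. norm (x q) \<le> B" for t x B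
    proof -
      have h: "0 \<le> delay_span \<sigma>max \<eta>"
        using \<eta>_ge[of 0] cmin by (simp add: delay_span_def)
      \<comment> \<open>The window contains \<open>t\<close> itself, which forces \<open>B\<close>
        to be nonnegative; this is needed to replace \<open>card (Q t)\<close> by
        \<open>\<sigma>max\<close>.\<close>
      have "0 \<le> norm (x t)" by simp
      also have "norm (x t) \<le> B" using B h by simp
      finally have B0: "0 \<le> B" .
      \<comment> \<open>Every delay is positive and at most the delay span, so each
        \<open>t - \<tau> s\<close> lies in the window where \<open>B\<close> applies.\<close>
      have "norm (\<Sum>s\<in>Q t. x (t - \<tau> s)) \<le> (\<Sum>s\<in>Q t. B)"
        by (rule sum_norm_le) (use B delay[OF t] in force)
      also have "\<dots> \<le> real \<sigma>max * B" using Q(2)[OF t] B0 by (simp add: mult_right_mono)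
      finally have "spectral_norm L * norm (\<Sum>s\<in>Q t. x (t - \<tau> s)) \<le> spectral_norm L * (real \<sigma>max * B)"
        by (rule mult_left_mono) (rule spectral_norm_nonneg)
      with norm_matrix_vector_le[of L "\<Sum>s\<in>Q t. x (t - \<tau> s)"] show ?thesis by simp
    qed
    show "0 \<le> delay_span \<sigma>max \<eta>" using \<eta>_ge[of 0] cmin by (simp add: delay_span_def)
  qed (use \<eta>_ge cmin dominance in auto)
qed

end
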